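(* Let $F=([k],A_F)$ be a motif and let $\mathcal{G}=([n],A,\alpha)$ be an irreducible network. Suppose $\mathtt{t}(F,\mathcal{G})>0$ and let $(\mathbf{x}_t)_{t\ge 0}$ be the Glauber chain of homomorphisms $F\to\mathcal{G}$. Then: (i) $\pi_{F\to\mathcal{G}}$ is a stationary distribution for the Glauber chain. (ii) Suppose $F$ is a rooted tree motif and $\mathcal{G}$ is bidirectional. Then the Glauber chain is irreducible if and only if $\mathcal{G}$ is not bipartite. If $\mathcal{G}$ is not bipartite, then $\pi_{F\to\mathcal{G}}$ is the unique stationary distribution for the Glauber chain.
   Context: For an integer $m\ge1$, $[m]=\{1,\dots,m\}$. A network is a triple $\mathcal{G}=([n],A,\alpha)$ with $A:[n]^2\to[0,\infty)$ (not necessarily symmetric) and $\alpha:[n]\to(0,1]$ a probability measure on $[n]$. A motif is a pair $F=([k],A_F)$ with $k\ge 1$ and $A_F:[k]^2\to[0,\infty)$. The convention $0^0=1$ is used. For $\mathbf{x}:[k]\to[n]$ define $$\mathtt{t}(F,\mathcal{G})=\sum_{\mathbf{x}:[k]\to[n]}\Big(\prod_{1\le i,j\le k}A(\mathbf{x}(i),\mathbf{x}(j))^{A_F(i,j)}\Big)\alpha(\mathbf{x}(1))\cdots\alpha(\mathbf{x}(k)),$$ $$\pi_{F\to\mathcal{G}}(\mathbf{x})=\frac{1}{\mathtt{t}(F,\mathcal{G})}\Big(\prod_{1\le i,j\le k}A(\mathbf{x}(i),\mathbf{x}(j))^{A_F(i,j)}\Big)\alpha(\mathbf{x}(1))\cdots\alpha(\mathbf{x}(k)).$$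 A map $\mathbf{x}$ is a homomorphism $F\to\mathcal{G}$ if $\pi_{F\to\mathcal{G}}(\mathbf{x})>0$. Glauber chain: the Markov chain of homomorphisms $F\to\mathcal{G}$, started from a fixed homomorphism $\mathbf{x}_0$, which moves from $\mathbf{x}_t$ to $\mathbf{x}_{t+1}$ as follows: choose $i\in[k]$ uniformly at random; set $\mathbf{x}_{t+1}(j)=\mathbf{x}_t(j)$ for $j\neq i$; set $\mathbf{x}_{t+1}(i)=b$ with probability $$\frac{\big(\prod_{j\ne i}A(\mathbf{x}_t(j),b)^{A_F(j,i)}A(b,\mathbf{x}_t(j))^{A_F(i,j)}\big)A(b,b)^{A_F(i,i)}\alpha(b)}{\sum_{c\in[n]}\big(\prod_{j\ne i}A(\mathbf{x}_t(j),c)^{A_F(j,i)}A(c,\mathbf{x}_t(j))^{A_F(i,j)}\big)A(c,c)^{A_F(i,i)}\alpha(c)}.$$ Rooted tree motif: $F=([k],A_F)$ is an edge-weighted directed tree rooted at node $1$ without loops; that is, $A_F=0$ if $k=1$, and if $k\ge2$, for each $2\le i\le k$ there is a unique $j\in[k]$, $j\ne i$, with $A_F(j,i)>0$; this $j$ is denoted $i^-$ (the parent of $i$), and the nodes are ordered so that $i^-<i$. The network $\mathcal{G}$ is irreducible if the random walk on $[n]$ with transition kernel $$\Psi(a,b)=\frac{\alpha(a)\max(A(a,b),A(b,a))\alpha(b)}{\sum_{c\in[n]}\alpha(a)\max(A(a,c),A(c,a))\alpha(c)}$$ visits all nodes with positive probability. It is bidirectional if $A(i,j)>0\iff A(j,i)>0$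 for all $i,j\in[n]$. Its skeleton is the graph on $[n]$ with adjacency matrix $A_G(i,j)=\mathbf{1}(\min(A(i,j),A(j,i))>0)$. $\mathcal{G}$ is not bipartite if and only if its skeleton contains an odd cycle.
   Formalization: In (ii), "the Glauber chain is irreducible only if G is not bipartite" is stated for k ≥ 2 only; for k = 1 it fails, e.g. n = 2, A(1,2) = A(2,1) = 1, A(1,1) = A(2,2) = 0, α = 1/2, where the chain is irreducible but G is bipartite. *)

theory Defs
  imports Complex_Main "HOL-Library.FuncSet"
begin

section \<open>Finite Markov kernels\<close>

fun kernel_power :: "'s set \<Rightarrow> ('s \<Rightarrow> 's \<Rightarrow> real) \<Rightarrow> nat \<Rightarrow> 's \<Rightarrow> 's \<Rightarrow> real" where
  "kernel_power S P 0 x y = (if x = y then 1 else 0)"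
| "kernel_power S P (Suc m) x y = (\<Sum>z\<in>S. P x z * kernel_power S P m z y)"

definition irreducible_kernel :: "'s set \<Rightarrow> ('s \<Rightarrow> 's \<Rightarrow> real) \<Rightarrow> bool" where
  "irreducible_kernel S P \<longleftrightarrow> (\<forall>x\<in>S. \<forall>y\<in>S. \<exists>m. kernel_power S P m x y > 0)"

definition stationary_distribution :: "'s set \<Rightarrow> ('s \<Rightarrow> 's \<Rightarrow> real) \<Rightarrow> ('s \<Rightarrow> real) \<Rightarrow> bool" where
  "stationary_distribution S P \<mu> \<longleftrightarrow>
     (\<forall>x\<in>S. \<mu> x \<ge> 0) \<and> (\<Sum>x\<in>S. \<mu> x) = 1 \<and>
     (\<forall>y\<in>S. (\<Sum>x\<in>S. \<mu> x * P x y) = \<mu> y)"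


section \<open>Networks and motifs\<close>

definition network :: "nat \<Rightarrow> (nat \<Rightarrow> nat \<Rightarrow> real) \<Rightarrow> (nat \<Rightarrow> real) \<Rightarrow> bool" where
  "network n A \<alpha> \<longleftrightarrow> n \<ge> 1 \<and>
     (\<forall>a\<in>{1..n}. \<forall>b\<in>{1..n}. A a b \<ge> 0) \<and>
     (\<forall>a\<in>{1..n}. 0 < \<alpha> a \<and> \<alpha> a \<le> 1) \<and> (\<Sum>a\<in>{1..n}. \<alpha> a) = 1"

definition motif :: "nat \<Rightarrow> (nat \<Rightarrow> nat \<Rightarrow> real) \<Rightarrow> bool" where
  "motif k F \<longleftrightarrow> k \<ge> 1 \<and> (\<forall>i\<in>{1..k}. \<forall>j\<in>{1..k}. F i j \<ge> 0)"

text \<open>The walk kernel. Its denominator can vanish at a node \<open>a\<close> only if \<open>A a c = A c a = 0\<close>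
  for all \<open>c\<close>; then the row at \<open>a\<close> is zero and \<open>a\<close> reaches no other node.\<close>

definition walk_kernel ::
  "nat \<Rightarrow> (nat \<Rightarrow> nat \<Rightarrow> real) \<Rightarrow> (nat \<Rightarrow> real) \<Rightarrow> nat \<Rightarrow> nat \<Rightarrow> real" where
  "walk_kernel n A \<alpha> a b =
     \<alpha> a * max (A a b) (A b a) * \<alpha> b / (\<Sum>c\<in>{1..n}. \<alpha> a * max (A a c) (A c a) * \<alpha> c)"

definition irreducible_network ::
  "nat \<Rightarrow> (nat \<Rightarrow> nat \<Rightarrow> real) \<Rightarrow> (nat \<Rightarrow> real) \<Rightarrow> bool" where
  "irreducible_network n A \<alpha> \<longleftrightarrow> irreducible_kernel {1..n} (walk_kernel n A \<alpha>)"

definition bidirectional :: "nat \<Rightarrow> (nat \<Rightarrow> nat \<Rightarrow> real) \<Rightarrow> bool" where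
  "bidirectional n A \<longleftrightarrow> (\<forall>a\<in>{1..n}. \<forall>b\<in>{1..n}. A a b > 0 \<longleftrightarrow> A b a > 0)"

definition skeleton :: "(nat \<Rightarrow> nat \<Rightarrow> real) \<Rightarrow> nat \<Rightarrow> nat \<Rightarrow> bool" where
  "skeleton A a b \<longleftrightarrow> min (A a b) (A b a) > 0"

text \<open>A cycle is the list of its pairwise distinct vertices in cyclic order. The skeleton may have
  loops, and a loop is an odd cycle (of length one).\<close>

definition odd_cycle :: "nat \<Rightarrow> (nat \<Rightarrow> nat \<Rightarrow> bool) \<Rightarrow> nat list \<Rightarrow> bool" where
  "odd_cycle n E c \<longleftrightarrow> odd (length c) \<and> distinct c \<and> set c \<subseteq> {1..n} \<and>
     (\<forall>i<length c. E (c ! i) (c ! (Suc i mod length c)))"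

definition bipartite :: "nat \<Rightarrow> (nat \<Rightarrow> nat \<Rightarrow> real) \<Rightarrow> bool" where
  "bipartite n A \<longleftrightarrow> (\<nexists>c. odd_cycle n (skeleton A) c)"

text \<open>Rooted tree at node \<open>1\<close>: no loops, nothing points to the root, and every other node has
  exactly one parent, which precedes it.\<close>

definition rooted_tree_motif :: "nat \<Rightarrow> (nat \<Rightarrow> nat \<Rightarrow> real) \<Rightarrow> bool" where
  "rooted_tree_motif k F \<longleftrightarrow> motif k F \<and>
     (\<forall>i\<in>{1..k}. F i i = 0) \<and>
     (\<forall>j\<in>{1..k}. F j 1 = 0) \<and>
     (\<forall>i\<in>{2..k}. \<exists>!j. j \<in> {1..k} \<and> j \<noteq> i \<and> F j i > 0) \<and>
     (\<forall>i\<in>{2..k}. \<forall>j\<in>{1..k}. F j i > 0 \<longrightarrow> j < i)"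


section \<open>Homomorphisms and the Glauber chain\<close>

text \<open>Real power with the convention \<open>0\<^sup>0 = 1\<close>; in contrast, \<open>0 powr 0 = 0\<close>.\<close>

definition rpow :: "real \<Rightarrow> real \<Rightarrow> real" where
  "rpow a p = (if p = 0 then 1 else a powr p)"

definition hom_weight ::
  "nat \<Rightarrow> (nat \<Rightarrow> nat \<Rightarrow> real) \<Rightarrow> (nat \<Rightarrow> nat \<Rightarrow> real) \<Rightarrow> (nat \<Rightarrow> real) \<Rightarrow> (nat \<Rightarrow> nat) \<Rightarrow> real" where
  "hom_weight k F A \<alpha> x =
     (\<Prod>i\<in>{1..k}. \<Prod>j\<in>{1..k}. rpow (A (x i) (x j)) (F i j)) * (\<Prod>i\<in>{1..k}. \<alpha> (x i))"

definition hom_density ::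
  "nat \<Rightarrow> (nat \<Rightarrow> nat \<Rightarrow> real) \<Rightarrow> nat \<Rightarrow> (nat \<Rightarrow> nat \<Rightarrow> real) \<Rightarrow> (nat \<Rightarrow> real) \<Rightarrow> real" where
  "hom_density k F n A \<alpha> = (\<Sum>x\<in>{1..k} \<rightarrow>\<^sub>E {1..n}. hom_weight k F A \<alpha> x)"

definition hom_dist ::
  "nat \<Rightarrow> (nat \<Rightarrow> nat \<Rightarrow> real) \<Rightarrow> nat \<Rightarrow> (nat \<Rightarrow> nat \<Rightarrow> real) \<Rightarrow> (nat \<Rightarrow> real) \<Rightarrow> (nat \<Rightarrow> nat) \<Rightarrow> real" where
  "hom_dist k F n A \<alpha> x = hom_weight k F A \<alpha> x / hom_density k F n A \<alpha>"

definition homs ::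
  "nat \<Rightarrow> (nat \<Rightarrow> nat \<Rightarrow> real) \<Rightarrow> nat \<Rightarrow> (nat \<Rightarrow> nat \<Rightarrow> real) \<Rightarrow> (nat \<Rightarrow> real) \<Rightarrow> (nat \<Rightarrow> nat) set" where
  "homs k F n A \<alpha> = {x \<in> {1..k} \<rightarrow>\<^sub>E {1..n}. hom_dist k F n A \<alpha> x > 0}"

definition site_weight ::
  "nat \<Rightarrow> (nat \<Rightarrow> nat \<Rightarrow> real) \<Rightarrow> (nat \<Rightarrow> nat \<Rightarrow> real) \<Rightarrow> (nat \<Rightarrow> real)
    \<Rightarrow> (nat \<Rightarrow> nat) \<Rightarrow> nat \<Rightarrow> nat \<Rightarrow> real" where
  "site_weight k F A \<alpha> x i b =
     (\<Prod>j\<in>{1..k} - {i}. rpow (A (x j) b) (F j i) * rpow (A b (x j)) (F i j))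
     * rpow (A b b) (F i i) * \<alpha> b"

definition glauber_kernel ::
  "nat \<Rightarrow> (nat \<Rightarrow> nat \<Rightarrow> real) \<Rightarrow> nat \<Rightarrow> (nat \<Rightarrow> nat \<Rightarrow> real) \<Rightarrow> (nat \<Rightarrow> real)
    \<Rightarrow> (nat \<Rightarrow> nat) \<Rightarrow> (nat \<Rightarrow> nat) \<Rightarrow> real" where
  "glauber_kernel k F n A \<alpha> x y =
     (\<Sum>i\<in>{1..k}. \<Sum>b\<in>{1..n}.
        1 / real k * (site_weight k F A \<alpha> x i b / (\<Sum>c\<in>{1..n}. site_weight k F A \<alpha> x i c))
        * (if y = x(i := b) then 1 else 0))"

end

theory Submission
  imports Defs
begin

text \<open>
  Write a homomorphism weight as a factor that does not involve node \<open>i\<close> times the site weight of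
  \<open>i\<close>. Resampling \<open>i\<close> draws its image with probability proportional to the site weight, so the
  chain satisfies detailed balance with respect to the homomorphism distribution
  (\<open>reversible_glauber\<close>), and its positive steps are exactly the changes of one value that lead
  to a homomorphism (\<open>kernel_step_iff_single_site_move\<close>). Detailed balance gives stationarity.
  It also makes the density of any stationary measure harmonic, hence constant if the chain is
  irreducible, by the maximum principle (\<open>reversible_stationary_unique\<close>).

  For a tree motif in a bidirectional network, homomorphisms are the graph homomorphisms from the
  tree to the skeleton, which is connected. Irreducibility thus becomes a combinatorial question:
  are any two of them joined by moves that change one value at a time?

  Suppose the skeleton has an odd cycle. Then any two vertices are joined by a walk of even
  length, since a detour around the cycle repairs the parity. For a tree with a single edge, both
  ends of the edge move in turn along such a walk (\<open>edges_connected_by_moves\<close>). Larger trees grow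
  leaf by leaf. Before the parent of the new leaf moves, the leaf is folded onto another
  neighbour of the parent, and then it does not obstruct the move (\<open>lift_moves_to_leaf\<close>).

  Conversely, in a tree with at least two nodes every move of the root has length two in the
  skeleton, because the image of a child stays adjacent to it. Both orientations of a skeleton
  edge are images of homomorphisms. If they are joined by moves, then the ends of the edge are
  joined by an even walk, which together with the edge is a closed walk of odd length; a shortest
  such walk is an odd cycle (\<open>connected_imp_odd_cycle\<close>, \<open>odd_closed_walk_imp_odd_cycle\<close>).
\<close>

section \<open>Finite kernels: reachability, reversibility, uniqueness\<close>

definition kernel_step :: "'s set \<Rightarrow> ('s \<Rightarrow> 's \<Rightarrow> real) \<Rightarrow> 's \<Rightarrow> 's \<Rightarrow> bool" where
  "kernel_step S P x y \<longleftrightarrow> x \<in> S \<and> y \<in> S \<and> P x y > 0"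

lemma kernel_power_nonneg:
  assumes "\<forall>x\<in>S. \<forall>y\<in>S. P x y \<ge> 0" and "x \<in> S"
  shows "kernel_power S P m x y \<ge> 0"
  using assms(2)
proof (induction m arbitrary: x)
  case (Suc m)
  then show ?case using assms(1) by (auto intro!: sum_nonneg mult_nonneg_nonneg)
qed simp

lemma irreducible_kernel_iff_reachable:
  assumes fin: "finite S" and nonneg: "\<forall>x\<in>S. \<forall>y\<in>S. P x y \<ge> 0"
  shows "irreducible_kernel S P \<longleftrightarrow> (\<forall>x\<in>S. \<forall>y\<in>S. (kernel_step S P)\<^sup>*\<^sup>* x y)"
proof -
  have "(kernel_step S P)\<^sup>*\<^sup>* x y"
    if "kernel_power S P m x y > 0" "x \<in> S" "y \<in> S" for m x y
    using that
  proof (induction m arbitrary: x)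
    case 0
    then show ?case by (simp split: if_splits)
  next
    case (Suc m)
    from Suc.prems(1) obtain z where z: "z \<in> S" "P x z * kernel_power S P m z y > 0"
      by (metis (no_types, lifting) kernel_power.simps(2) less_le_not_le linorder_le_less_linear sum_nonpos)
    have "P x z \<ge> 0" "kernel_power S P m z y \<ge> 0"
      using nonneg z Suc.prems kernel_power_nonneg[OF nonneg] by auto
    with z have pos: "P x z > 0" "kernel_power S P m z y > 0"
      by (auto simp: zero_less_mult_iff)
    have "kernel_step S P x z" using pos z Suc.prems by (simp add: kernel_step_def)
    with Suc.IH[OF pos(2) z(1) Suc.prems(3)] show ?case
      by (rule converse_rtranclp_into_rtranclp[rotated])
  qed
  moreover have "\<exists>m. kernel_power S P m x y > 0" if "(kernel_step S P)\<^sup>*\<^sup>* x y" for x y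
    using that
  proof (induction rule: converse_rtranclp_induct)
    case base
    have "kernel_power S P 0 y y > 0" by simp
    then show ?case ..
  next
    case (step x z)
    then obtain m where m: "kernel_power S P m z y > 0" by blast
    have z: "x \<in> S" "z \<in> S" "P x z > 0" using step by (auto simp: kernel_step_def)
    have "kernel_power S P (Suc m) x y > 0"
      unfolding kernel_power.simps
      by (rule sum_pos2[OF fin z(2)])
        (use m z nonneg kernel_power_nonneg[OF nonneg] in auto)
    then show ?case ..
  qed
  ultimately show ?thesis unfolding irreducible_kernel_def by blast
qed

definition reversible :: "'s set \<Rightarrow> ('s \<Rightarrow> 's \<Rightarrow> real) \<Rightarrow> ('s \<Rightarrow> real) \<Rightarrow> bool" where
  "reversible S P \<pi> \<longleftrightarrow> (\<forall>x\<in>S. \<forall>y\<in>S. \<pi> x * P x y = \<pi> y * P y x)"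

definition stochastic :: "'s set \<Rightarrow> ('s \<Rightarrow> 's \<Rightarrow> real) \<Rightarrow> bool" where
  "stochastic S P \<longleftrightarrow> (\<forall>x\<in>S. (\<forall>y\<in>S. P x y \<ge> 0) \<and> (\<Sum>y\<in>S. P x y) = 1)"

lemma reversible_imp_stationary:
  assumes "stochastic S P" and "reversible S P \<pi>"
    and "\<forall>x\<in>S. \<pi> x \<ge> 0" and "(\<Sum>x\<in>S. \<pi> x) = 1"
  shows "stationary_distribution S P \<pi>"
proof -
  have "(\<Sum>x\<in>S. \<pi> x * P x y) = \<pi> y" if "y \<in> S" for y
  proof -
    have "(\<Sum>x\<in>S. \<pi> x * P x y) = (\<Sum>x\<in>S. \<pi> y * P y x)"
      using assms(2) that by (intro sum.cong) (auto simp: reversible_def)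
    also have "\<dots> = \<pi> y"
      using assms(1) that by (simp add: stochastic_def flip: sum_distrib_left)
    finally show ?thesis .
  qed
  with assms show ?thesis by (auto simp: stationary_distribution_def)
qed

text \<open>Maximum principle: at a point where a harmonic function is maximal, its value is an average
  of values that are at most as large, so they are all equal to it. The maximum thus spreads along
  every step of the chain.\<close>

lemma harmonic_constant:
  assumes fin: "finite S" and stoch: "stochastic S P"
    and conn: "\<forall>x\<in>S. \<forall>y\<in>S. (kernel_step S P)\<^sup>*\<^sup>* x y"
    and harm: "\<forall>x\<in>S. f x = (\<Sum>y\<in>S. P x y * f y)"
    and "x \<in> S" "y \<in> S"
  shows "f x = (f y :: real)"
proof -
  define M where "M = Max (f ` S)"
  have le: "f z \<le> M" if "z \<in> S" for z
    unfolding M_def using fin that by simp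
  obtain x0 where x0: "x0 \<in> S" "f x0 = M"
    unfolding M_def using Max_in[of "f ` S"] fin \<open>x \<in> S\<close> by fastforce
  have spread: "f v = M" if "kernel_step S P u v" "f u = M" for u v
  proof -
    have uv: "u \<in> S" "v \<in> S" "P u v > 0" using that by (auto simp: kernel_step_def)
    have "(\<Sum>z\<in>S. P u z * (M - f z)) = (\<Sum>z\<in>S. P u z) * M - (\<Sum>z\<in>S. P u z * f z)"
      by (simp add: algebra_simps sum_subtractf sum_distrib_left)
    also have "\<dots> = 0"
      using uv stoch that harm by (simp add: stochastic_def)
    finally have "(\<Sum>z\<in>S. P u z * (M - f z)) = 0" .
    moreover have "P u z * (M - f z) \<ge> 0" if "z \<in> S" for z
      using le[OF that] stoch uv that by (simp add: stochastic_def)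
    ultimately have "\<forall>z\<in>S. P u z * (M - f z) = 0"
      using fin by (simp only: sum_nonneg_eq_0_iff)
    with uv have "P u v * (M - f v) = 0" by blast
    with uv show ?thesis by simp
  qed
  have "f z = M" if "z \<in> S" for z
  proof -
    have "(kernel_step S P)\<^sup>*\<^sup>* x0 z" using conn x0 that by blast
    then show ?thesis by (induction rule: rtranclp_induct) (use x0 spread in auto)
  qed
  with assms show ?thesis by metis
qed

text \<open>Detailed balance turns the stationarity of \<open>\<mu>\<close> into the harmonicity of the density
  \<open>\<mu> / \<pi>\<close>, which is then constant by the maximum principle.\<close>

lemma reversible_stationary_unique:
  assumes fin: "finite S" and stoch: "stochastic S P" and rev: "reversible S P \<pi>"
    and irr: "irreducible_kernel S P"
    and pos: "\<forall>x\<in>S. \<pi> x > 0" and one: "(\<Sum>x\<in>S. \<pi> x) = 1"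
    and stat: "stationary_distribution S P \<mu>" and "x \<in> S"
  shows "\<mu> x = \<pi> x"
proof -
  define f where "f z = \<mu> z / \<pi> z" for z
  have mu: "\<mu> z = \<pi> z * f z" if "z \<in> S" for z
    using pos that by (simp add: f_def less_imp_neq[symmetric])
  have nonneg: "\<forall>x\<in>S. \<forall>y\<in>S. P x y \<ge> 0"
    using stoch by (auto simp: stochastic_def)
  have "f y = (\<Sum>z\<in>S. P y z * f z)" if y: "y \<in> S" for y
  proof -
    have "\<pi> y * f y = (\<Sum>z\<in>S. \<mu> z * P z y)"
      using stat y by (simp add: stationary_distribution_def flip: mu)
    also have "\<dots> = (\<Sum>z\<in>S. \<pi> y * (P y z * f z))"
    proof (rule sum.cong[OF refl])
      fix z assume z: "z \<in> S"
      have "\<pi> z * P z y = \<pi> y * P y z" using rev y z by (simp add: reversible_def)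
      then have "(\<pi> z * P z y) * f z = (\<pi> y * P y z) * f z" by simp
      then show "\<mu> z * P z y = \<pi> y * (P y z * f z)"
        unfolding mu[OF z] by (simp only: mult.assoc mult.commute[of "f z"])
    qed
    also have "\<dots> = \<pi> y * (\<Sum>z\<in>S. P y z * f z)" by (simp add: sum_distrib_left)
    finally show ?thesis using pos y by (metis less_irrefl mult_cancel_left)
  qed
  then have harm: "\<forall>y\<in>S. f y = (\<Sum>z\<in>S. P y z * f z)" by blast
  have conn: "\<forall>x\<in>S. \<forall>y\<in>S. (kernel_step S P)\<^sup>*\<^sup>* x y"
    using irr unfolding irreducible_kernel_iff_reachable[OF fin nonneg] .
  have const: "f y = f x" if "y \<in> S" for y
    by (rule harmonic_constant[OF fin stoch conn harm that \<open>x \<in> S\<close>])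
  have "1 = (\<Sum>z\<in>S. \<mu> z)" using stat by (simp add: stationary_distribution_def)
  also have "\<dots> = (\<Sum>z\<in>S. \<pi> z * f x)" by (intro sum.cong) (auto simp: mu const)
  also have "\<dots> = f x" using one by (simp flip: sum_distrib_right)
  finally show ?thesis using mu[OF \<open>x \<in> S\<close>] by simp
qed

section \<open>Even walks and odd cycles in graphs\<close>

lemma even_or_odd_walk:
  assumes "E\<^sup>*\<^sup>* a b"
  shows "(E OO E)\<^sup>*\<^sup>* a b \<or> (\<exists>c. (E OO E)\<^sup>*\<^sup>* a c \<and> E c b)"
  using assms
proof (induction rule: rtranclp_induct)
  case (step b c)
  then show ?case by (meson relcompp.relcompI rtranclp.rtrancl_into_rtrancl)
qed simp

lemma symp_even_walk:
  assumes "symp E"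
  shows "symp ((E OO E)\<^sup>*\<^sup>*)"
proof (rule symp_rtranclp)
  show "symp (E OO E)" using assms by (auto simp: symp_def)
qed

text \<open>A closed odd walk at a vertex \<open>v\<close> of the cycle corrects the parity: a walk that reaches \<open>v\<close>
  after an odd number of steps continues once around the cycle.\<close>

lemma odd_cycle_imp_even_walks:
  assumes sym: "symp E" and conn: "\<forall>a\<in>{1..n}. \<forall>b\<in>{1..n}. E\<^sup>*\<^sup>* a b"
    and cyc: "odd_cycle n E c" and a: "a \<in> {1..n}" and b: "b \<in> {1..n}"
  shows "(E OO E)\<^sup>*\<^sup>* a b"
proof -
  let ?L = "length c"
  have E: "E (c ! i) (c ! (Suc i mod ?L))" if "i < ?L" for i
    using cyc that by (simp add: odd_cycle_def)
  have odd: "odd ?L" and V: "set c \<subseteq> {1..n}" using cyc by (auto simp: odd_cycle_def)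
  have pos: "0 < ?L" using odd by (rule odd_pos)
  have walk: "(E OO E)\<^sup>*\<^sup>* (c ! 0) (c ! (2 * i))" if "2 * i < ?L" for i
    using that
  proof (induction i)
    case (Suc i)
    have "E (c ! (2 * i)) (c ! Suc (2 * i))" "E (c ! Suc (2 * i)) (c ! (2 * Suc i))"
      using E[of "2 * i"] E[of "Suc (2 * i)"] Suc.prems by simp_all
    then have "(E OO E) (c ! (2 * i)) (c ! (2 * Suc i))" by blast
    with Suc show ?case by simp
  qed simp
  define v w where "v = c ! 0" and "w = c ! (?L - 1)"
  have vw: "(E OO E)\<^sup>*\<^sup>* v w"
    using walk[of "(?L - 1) div 2"] odd pos by (simp add: v_def w_def)
  have "E w v" using E[of "?L - 1"] pos by (simp add: v_def w_def)
  then have Evw: "E v w" using sym by (rule sympD[rotated])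
  have v: "v \<in> {1..n}" using V nth_mem[OF pos] by (auto simp only: v_def)
  have to_v: "(E OO E)\<^sup>*\<^sup>* u v" if "u \<in> {1..n}" for u
  proof -
    have "E\<^sup>*\<^sup>* u v" using conn that v by blast
    from even_or_odd_walk[OF this]
    consider "(E OO E)\<^sup>*\<^sup>* u v" | d where "(E OO E)\<^sup>*\<^sup>* u d" "E d v"
      by metis
    then show ?thesis
    proof cases
      case d: (2 d)
      from d(2) have "(E OO E) d w" using Evw by blast
      moreover have "(E OO E)\<^sup>*\<^sup>* w v" using vw symp_even_walk[OF sym] by (rule sympD[rotated])
      ultimately show ?thesis using d by (meson converse_rtranclp_into_rtranclp rtranclp_trans)
    qed
  qed
  have "(E OO E)\<^sup>*\<^sup>* v b" using to_v[OF b] symp_even_walk[OF sym] by (rule sympD[rotated])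
  with to_v[OF a] show ?thesis by (rule rtranclp_trans)
qed

text \<open>A closed walk that repeats a vertex splits there into two shorter closed walks, and if the
  length is odd, then one of the two lengths is odd.\<close>

lemma odd_closed_walk_imp_odd_cycle:
  assumes "odd L" and "w L = w 0" and "\<forall>i<L. E (w i) (w (Suc i))" and "\<forall>i<L. w i \<in> {1..n}"
  shows "\<exists>c. odd_cycle n E c"
  using assms
proof (induction L arbitrary: w rule: less_induct)
  case (less L)
  have step: "E (w i) (w (Suc i))" "w i \<in> {1..n}" if "i < L" for i
    using less.prems that by auto
  show ?case
  proof (cases "inj_on w {..<L}")
    case True
    have "E (w i) (w (Suc i mod L))" if "i < L" for i
      using step[OF that] less.prems(2) that by (cases "Suc i = L") auto
    then have "odd_cycle n E (map w [0..<L])"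
      unfolding odd_cycle_def using True less.prems(1) step
      by (auto simp: distinct_map atLeast0LessThan)
    then show ?thesis ..
  next
    case False
    then obtain i j where ij: "i < j" "j < L" "w i = w j"
      unfolding inj_on_def by (metis lessThan_iff linorder_neqE_nat)
    show ?thesis
    proof (cases "odd (j - i)")
      case True
      show ?thesis
        by (rule less.IH[of "j - i" "\<lambda>t. w (i + t)"]) (use ij True step in auto)
    next
      case False
      define u where "u t = (if t < i then w t else w (t + (j - i)))" for t
      have "E (u t) (u (Suc t)) \<and> u t \<in> {1..n}" if t: "t < L - (j - i)" for t
      proof -
        consider "Suc t < i" | "Suc t = i" | "i \<le> t" by linarith
        then show ?thesis
        proof cases
          case 2
          \<comment> \<open>the step across the seam uses the repeated vertex\<close>
          with ij have "u (Suc t) = w (Suc t)" by (simp add: u_def)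
          with 2 show ?thesis using step[of t] ij by (simp add: u_def)
        qed (use step[of t] step[of "t + (j - i)"] ij t in \<open>auto simp: u_def\<close>)
      qed
      moreover have "u (L - (j - i)) = u 0"
        using ij less.prems(2) by (auto simp: u_def)
      moreover have "odd (L - (j - i))"
        using False less.prems(1) ij by simp
      ultimately show ?thesis
        using ij by (intro less.IH[of "L - (j - i)" u]) auto
    qed
  qed
qed

lemma even_walk_edge_imp_odd_cycle:
  assumes walk: "(E OO E)\<^sup>*\<^sup>* a b" and edge: "E b a"
    and V: "\<And>a b. E a b \<Longrightarrow> a \<in> {1..n} \<and> b \<in> {1..n}"
  shows "\<exists>c. odd_cycle n E c"
proof -
  have "\<exists>m. (E ^^ (2 * m)) a b"
    using walk
  proof (induction rule: rtranclp_induct)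
    case base
    have "(E ^^ (2 * 0)) a a" by simp
    then show ?case ..
  next
    case (step b c)
    then obtain m where "(E ^^ (2 * m)) a b" by blast
    with step have "(E ^^ (2 * Suc m)) a c" by auto
    then show ?case ..
  qed
  then obtain m where "(E ^^ Suc (2 * m)) a a" using edge by auto
  then obtain w where w: "w 0 = a" "w (Suc (2 * m)) = a" "\<forall>i<Suc (2 * m). E (w i) (w (Suc i))"
    by (auto simp only: relpowp_fun_conv)
  show ?thesis
    by (rule odd_closed_walk_imp_odd_cycle[of "Suc (2 * m)" w]) (use w V in auto)
qed

section \<open>Homomorphisms of a rooted tree\<close>

definition single_site_move :: "nat \<Rightarrow> (nat \<Rightarrow> nat) set \<Rightarrow> (nat \<Rightarrow> nat) \<Rightarrow> (nat \<Rightarrow> nat) \<Rightarrow> bool" where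
  "single_site_move k S x y \<longleftrightarrow> x \<in> S \<and> y \<in> S \<and> (\<exists>i\<in>{1..k}. \<exists>b. y = x(i := b))"

text \<open>The parent map \<open>p\<close> describes a tree on \<open>{1..k}\<close> by its values on \<open>{2..k}\<close>. Leaving \<open>k\<close> out of
  the locale parameters permits induction on \<open>k\<close>: passing from \<open>Suc k\<close> to \<open>k\<close> deletes the leaf
  \<open>Suc k\<close>.\<close>

locale tree_to_graph =
  fixes p :: "nat \<Rightarrow> nat" and E :: "nat \<Rightarrow> nat \<Rightarrow> bool" and n :: nat
  assumes sym: "symp E" and vertices: "E a b \<Longrightarrow> a \<in> {1..n} \<and> b \<in> {1..n}"
begin

definition parents_below :: "nat \<Rightarrow> bool" where
  "parents_below k \<longleftrightarrow> (\<forall>i\<in>{2..k}. p i \<in> {1..<i})"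

definition tree_homs :: "nat \<Rightarrow> (nat \<Rightarrow> nat) set" where
  "tree_homs k = {x \<in> {1..k} \<rightarrow>\<^sub>E {1..n}. \<forall>i\<in>{2..k}. E (x (p i)) (x i)}"

abbreviation connected_by_moves :: "nat \<Rightarrow> bool" where
  "connected_by_moves k \<equiv>
     \<forall>x\<in>tree_homs k. \<forall>y\<in>tree_homs k. (single_site_move k (tree_homs k))\<^sup>*\<^sup>* x y"

lemma parents_belowD:
  assumes "parents_below k" "i \<in> {2..k}"
  shows "1 \<le> p i" "p i < i"
  using assms by (auto simp: parents_below_def)

lemma parents_below_Suc: "parents_below (Suc k) \<Longrightarrow> parents_below k"
  by (simp add: parents_below_def)

lemma add_leaf_mem_tree_homs_iff:
  assumes "parents_below (Suc k)" and "k \<ge> 1" and x: "x \<in> tree_homs k"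
  shows "x(Suc k := a) \<in> tree_homs (Suc k) \<longleftrightarrow> E (x (p (Suc k))) a"
proof -
  let ?y = "x(Suc k := a)"
  have q: "1 \<le> p (Suc k)" "p (Suc k) < Suc k"
    using parents_belowD[OF assms(1), of "Suc k"] \<open>k \<ge> 1\<close> by auto
  have old: "E (?y (p i)) (?y i)" if "i \<in> {2..k}" for i
    using parents_belowD[OF assms(1), of i] x that by (simp add: tree_homs_def)
  have dom: "{1..Suc k} = insert (Suc k) {1..k}" "{2..Suc k} = insert (Suc k) {2..k}"
    using \<open>k \<ge> 1\<close> by auto
  have "?y \<in> {1..Suc k} \<rightarrow>\<^sub>E {1..n}" if "a \<in> {1..n}"
    using x that unfolding dom(1) by (intro PiE_fun_upd) (auto simp: tree_homs_def)
  then show ?thesis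
    using q old vertices[of "x (p (Suc k))" a] unfolding tree_homs_def dom(2) by auto
qed

lemma tree_homs_remove_leaf:
  assumes "parents_below (Suc k)" and "k \<ge> 1" and y: "y \<in> tree_homs (Suc k)"
  obtains x a where "x \<in> tree_homs k" "E (x (p (Suc k))) a" "y = x(Suc k := a)"
proof -
  let ?x = "y(Suc k := undefined)"
  have "E (?x (p i)) (?x i)" if "i \<in> {2..k}" for i
    using parents_belowD[OF assms(1), of i] y that by (simp add: tree_homs_def)
  moreover have "?x \<in> {1..k} \<rightarrow>\<^sub>E {1..n}"
  proof (rule PiE_I)
    show "?x i \<in> {1..n}" if "i \<in> {1..k}" for i
      using y that by (auto simp: tree_homs_def PiE_iff)
    show "?x i = undefined" if "i \<notin> {1..k}" for i
      using y that by (auto simp: tree_homs_def PiE_iff extensional_def)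
  qed
  ultimately have x: "?x \<in> tree_homs k" by (simp add: tree_homs_def)
  have "y = ?x(Suc k := y (Suc k))" by simp
  with add_leaf_mem_tree_homs_iff[OF assms(1,2) x] y show ?thesis
    by (metis that x)
qed

lemma ex_tree_neighbour:
  assumes "parents_below k" and "k \<ge> 2" and q: "q \<in> {1..k}"
  shows "\<exists>r\<in>{1..k}. r \<noteq> q \<and> (\<forall>x\<in>tree_homs k. E (x q) (x r))"
proof (cases "q = 1")
  case True
  have "p 2 = 1" using parents_belowD[OF assms(1), of 2] \<open>k \<ge> 2\<close> by simp
  with True show ?thesis using \<open>k \<ge> 2\<close>
    by (intro bexI[of _ 2]) (force simp: tree_homs_def)+
next
  case False
  then have q2: "q \<in> {2..k}" using q by auto
  show ?thesis
    using parents_belowD[OF assms(1) q2] q2 sym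
    by (intro bexI[of _ "p q"]) (auto simp: tree_homs_def dest: sympD)
qed

lemma root_edge:
  assumes "parents_below k" and "k \<ge> 2" and "x \<in> tree_homs k"
  shows "E (x 1) (x 2)"
proof -
  have "p 2 = 1" using parents_belowD[OF assms(1), of 2] \<open>k \<ge> 2\<close> by simp
  then show ?thesis using assms(2,3) by (auto simp: tree_homs_def dest!: bspec[of _ _ 2])
qed

text \<open>Every move of a homomorphism of the smaller tree lifts to the tree with one more leaf. The
  only obstacle is a move of the parent \<open>q\<close> of the leaf. As \<open>q\<close> has another neighbour \<open>r\<close> in the
  smaller tree, whose image is adjacent to the image of \<open>q\<close> before and after the move, the leaf
  is put on the image of \<open>r\<close> first.\<close>

lemma lift_moves_to_leaf:
  assumes par: "parents_below (Suc k)" and k: "k \<ge> 2"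
    and "(single_site_move k (tree_homs k))\<^sup>*\<^sup>* x y"
    and "x \<in> tree_homs k" and "E (x (p (Suc k))) a"
  shows "\<exists>b. E (y (p (Suc k))) b \<and>
    (single_site_move (Suc k) (tree_homs (Suc k)))\<^sup>*\<^sup>* (x(Suc k := a)) (y(Suc k := b))"
  using assms(3)
proof (induction rule: rtranclp_induct)
  case base
  with assms show ?case by auto
next
  case (step y z)
  let ?q = "p (Suc k)" and ?M = "single_site_move (Suc k) (tree_homs (Suc k))"
  obtain b where b: "E (y ?q) b" "?M\<^sup>*\<^sup>* (x(Suc k := a)) (y(Suc k := b))"
    using step.IH by blast
  obtain i c where yz: "y \<in> tree_homs k" "z \<in> tree_homs k" and i: "i \<in> {1..k}" "z = y(i := c)"
    using step.hyps(2) by (auto simp: single_site_move_def)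
  have q: "?q \<in> {1..k}"
    using parents_belowD[OF par, of "Suc k"] k by auto
  note mem = add_leaf_mem_tree_homs_iff[OF par]
  have move: "?M (y(Suc k := d)) (z(Suc k := d))" if "E (y ?q) d" "E (z ?q) d" for d
    unfolding single_site_move_def
  proof (intro conjI)
    show "y(Suc k := d) \<in> tree_homs (Suc k)" "z(Suc k := d) \<in> tree_homs (Suc k)"
      using mem yz that k by auto
    show "\<exists>i\<in>{1..Suc k}. \<exists>b. z(Suc k := d) = (y(Suc k := d))(i := b)"
      using i by (intro bexI[of _ i] exI[of _ c]) auto
  qed
  show ?case
  proof (cases "i = ?q")
    case False
    then have "z ?q = y ?q" using i by simp
    with b move[of b] show ?thesis by (metis rtranclp.rtrancl_into_rtrancl)
  next
    case True
    obtain r where r: "r \<noteq> ?q" "\<forall>h\<in>tree_homs k. E (h ?q) (h r)"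
      using ex_tree_neighbour[OF parents_below_Suc[OF par] k q] by blast
    have "z r = y r" using r True i by simp
    then have Er: "E (y ?q) (y r)" "E (z ?q) (y r)" using r yz by metis+
    have "?M (y(Suc k := b)) (y(Suc k := y r))"
      unfolding single_site_move_def
    proof (intro conjI)
      show "y(Suc k := b) \<in> tree_homs (Suc k)" "y(Suc k := y r) \<in> tree_homs (Suc k)"
        using mem yz b Er k by auto
      show "\<exists>i\<in>{1..Suc k}. \<exists>c. y(Suc k := y r) = (y(Suc k := b))(i := c)"
        by (intro bexI[of _ "Suc k"] exI[of _ "y r"]) auto
    qed
    with b(2) move[OF Er] have "?M\<^sup>*\<^sup>* (x(Suc k := a)) (z(Suc k := y r))"
      by (meson rtranclp.rtrancl_into_rtrancl)
    with Er show ?thesis by blast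
  qed
qed

text \<open>A homomorphism of the tree with two nodes is a directed edge. Its endpoints move in turn along
  a walk of even length, and then the head moves to the desired neighbour.\<close>

lemma edges_connected_by_moves:
  assumes "parents_below 2" and even: "\<forall>a\<in>{1..n}. \<forall>b\<in>{1..n}. (E OO E)\<^sup>*\<^sup>* a b"
  shows "connected_by_moves 2"
proof (intro ballI)
  fix x y assume x: "x \<in> tree_homs 2" and y: "y \<in> tree_homs 2"
  let ?M = "single_site_move 2 (tree_homs 2)"
  have "p 2 = 1" using parents_belowD[OF assms(1), of 2] by simp
  have mem: "z(1 := a, 2 := b) \<in> tree_homs 2" if "z \<in> tree_homs 2" "E a b" for z a b
  proof -
    have "{1..2::nat} = {1, 2}" "{2..2::nat} = {2}" by auto
    with that vertices[OF that(2)] \<open>p 2 = 1\<close> show ?thesis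
      by (auto simp: tree_homs_def PiE_iff extensional_def)
  qed
  have head: "?M z (z(2 := b))" if "z \<in> tree_homs 2" "E (z 1) b" for z b
    using mem[of z "z 1" b] that by (auto simp: single_site_move_def fun_upd_triv)
  have tail: "?M z (z(1 := c))" if "z \<in> tree_homs 2" "E c (z 2)" for z c
  proof -
    have "z(1 := c, 2 := z 2) = z(1 := c)" by auto
    with mem[of z c "z 2"] that show ?thesis by (auto simp: single_site_move_def)
  qed
  have reach: "\<exists>z. ?M\<^sup>*\<^sup>* x z \<and> z \<in> tree_homs 2 \<and> z 1 = c" if "(E OO E)\<^sup>*\<^sup>* (x 1) c" for c
    using that
  proof (induction rule: rtranclp_induct)
    case base
    show ?case using x by blast
  next
    case (step c f)
    then obtain z e where z: "?M\<^sup>*\<^sup>* x z" "z \<in> tree_homs 2" "z 1 = c" and e: "E c e" "E e f"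
      by auto
    have m1: "?M z (z(2 := e))" using head[of z e] z e by simp
    have m2: "?M (z(2 := e)) (z(2 := e, 1 := f))"
      using tail[of "z(2 := e)" f] m1 z e sym by (auto simp: single_site_move_def dest: sympD)
    from z(1) m1 m2 have "?M\<^sup>*\<^sup>* x (z(2 := e, 1 := f))"
      by (meson rtranclp.rtrancl_into_rtrancl)
    moreover have "z(2 := e, 1 := f) \<in> tree_homs 2"
      using m2 unfolding single_site_move_def by blast
    moreover have "(z(2 := e, 1 := f)) 1 = f" by simp
    ultimately show ?case by blast
  qed
  have edge_y: "E (y 1) (y 2)" by (rule root_edge[OF assms(1) _ y]) simp
  have "x 1 \<in> {1..n}" using root_edge[OF assms(1) _ x] vertices by blast
  then obtain z where z: "?M\<^sup>*\<^sup>* x z" "z \<in> tree_homs 2" "z 1 = y 1"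
    using reach[of "y 1"] even edge_y vertices by blast
  have "y = z(2 := y 2)"
  proof
    fix i :: nat
    consider "i = 1" | "i = 2" | "i \<notin> {1..2}" by force
    then show "y i = (z(2 := y 2)) i"
      by cases (use y z in \<open>auto simp: tree_homs_def PiE_iff extensional_def\<close>)
  qed
  with head[of z "y 2"] z edge_y have "?M z y" by simp
  with z(1) show "?M\<^sup>*\<^sup>* x y" by (meson rtranclp.rtrancl_into_rtrancl)
qed

lemma tree_homs_connected:
  assumes "k \<ge> 1" and "parents_below k"
    and even: "\<forall>a\<in>{1..n}. \<forall>b\<in>{1..n}. (E OO E)\<^sup>*\<^sup>* a b"
  shows "connected_by_moves k"
  using assms(1,2)
proof (induction k rule: nat_induct_at_least)
  case base
  have "single_site_move 1 (tree_homs 1) x y" if "x \<in> tree_homs 1" "y \<in> tree_homs 1" for x y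
  proof -
    have "y = x(1 := y 1)"
      using that by (auto simp: fun_eq_iff tree_homs_def PiE_iff extensional_def)
    with that show ?thesis by (auto simp: single_site_move_def)
  qed
  then show ?case by blast
next
  case (Suc k)
  let ?M = "single_site_move (Suc k) (tree_homs (Suc k))"
  show ?case
  proof (cases "k = 1")
    case True
    with edges_connected_by_moves even Suc.prems show ?thesis by (simp add: numeral_2_eq_2)
  next
    case False
    then have k: "k \<ge> 2" using Suc.hyps by simp
    show ?thesis
    proof (intro ballI)
      fix x y assume xy: "x \<in> tree_homs (Suc k)" "y \<in> tree_homs (Suc k)"
      obtain x' a where x': "x' \<in> tree_homs k" "E (x' (p (Suc k))) a" "x = x'(Suc k := a)"
        by (rule tree_homs_remove_leaf[OF Suc.prems Suc.hyps xy(1)])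
      obtain y' b where y': "y' \<in> tree_homs k" "E (y' (p (Suc k))) b" "y = y'(Suc k := b)"
        by (rule tree_homs_remove_leaf[OF Suc.prems Suc.hyps xy(2)])
      have "(single_site_move k (tree_homs k))\<^sup>*\<^sup>* x' y'"
        using Suc.IH[OF parents_below_Suc[OF Suc.prems]] x'(1) y'(1) by blast
      from lift_moves_to_leaf[OF Suc.prems k this x'(1,2)]
      obtain c where c: "E (y' (p (Suc k))) c" "?M\<^sup>*\<^sup>* x (y'(Suc k := c))"
        using x'(3) by blast
      have "y'(Suc k := c) \<in> tree_homs (Suc k)"
        using add_leaf_mem_tree_homs_iff[OF Suc.prems Suc.hyps y'(1)] c(1) by blast
      moreover have "y = (y'(Suc k := c))(Suc k := b)" using y'(3) by simp
      ultimately have "?M (y'(Suc k := c)) y"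
        unfolding single_site_move_def using xy(2) by (metis atLeastAtMost_iff le_add1 le_refl plus_1_eq_Suc)
      with c(2) show "?M\<^sup>*\<^sup>* x y" by (meson rtranclp.rtrancl_into_rtrancl)
    qed
  qed
qed

lemma ex_tree_hom_onto_edge:
  assumes "k \<ge> 1" and "parents_below k" and ab: "E a b"
  shows "\<exists>x\<in>tree_homs k. x 1 = a \<and> (\<forall>i\<in>{1..k}. x i \<in> {a, b})"
  using assms(1,2)
proof (induction k rule: nat_induct_at_least)
  case base
  have "(\<lambda>i. if i = 1 then a else undefined) \<in> tree_homs 1"
    using vertices[OF ab] by (auto simp: tree_homs_def PiE_iff extensional_def)
  then show ?case by (intro bexI) auto
next
  case (Suc k)
  then obtain x where x: "x \<in> tree_homs k" "x 1 = a" "\<forall>i\<in>{1..k}. x i \<in> {a, b}"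
    using parents_below_Suc by blast
  have "p (Suc k) \<in> {1..k}"
    using parents_belowD[OF Suc.prems, of "Suc k"] Suc.hyps by auto
  then obtain c where c: "c \<in> {a, b}" "E (x (p (Suc k))) c"
    using x(3) ab sympD[OF sym ab] by (metis insert_iff singletonD)
  have "x(Suc k := c) \<in> tree_homs (Suc k)"
    using add_leaf_mem_tree_homs_iff[OF Suc.prems Suc.hyps x(1)] c by blast
  moreover have "(x(Suc k := c)) 1 = a" "\<forall>i\<in>{1..Suc k}. (x(Suc k := c)) i \<in> {a, b}"
    using x c Suc.hyps by (auto simp: le_Suc_eq)
  ultimately show ?case by blast
qed

text \<open>When the root moves, the image of its child \<open>2\<close> is adjacent to both the old and the new image
  of the root. So moves only carry the root along even walks. Some homomorphism sends the
  root to one end of an edge and some other one sends it to the other end; if they are connected,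
  then the ends are joined by an even walk, and the edge closes it up to an odd one.\<close>

lemma connected_imp_odd_cycle:
  assumes "k \<ge> 2" and "parents_below k" and conn: "connected_by_moves k"
    and "x \<in> tree_homs k"
  shows "\<exists>c. odd_cycle n E c"
proof -
  note edge = root_edge[OF assms(2,1)]
  have invariant: "(E OO E)\<^sup>*\<^sup>* (u 1) (v 1)"
    if "(single_site_move k (tree_homs k))\<^sup>*\<^sup>* u v" for u v
    using that
  proof (induction rule: rtranclp_induct)
    case (step v w)
    then obtain i c where vw: "v \<in> tree_homs k" "w \<in> tree_homs k" and i: "w = v(i := c)"
      by (auto simp: single_site_move_def)
    show ?case
    proof (cases "i = 1")
      case True
      with i have "w 2 = v 2" by simp
      with edge[OF vw(1)] edge[OF vw(2)] have "(E OO E) (v 1) (w 1)"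
        using sym by (metis relcompp.relcompI sympD)
      with step.IH show ?thesis by (rule rtranclp.rtrancl_into_rtrancl)
    next
      case False
      with i step.IH show ?thesis by simp
    qed
  qed simp
  have ab: "E (x 1) (x 2)" using edge assms(4) by blast
  then have ba: "E (x 2) (x 1)" by (rule sympD[OF sym])
  have "k \<ge> 1" using \<open>k \<ge> 2\<close> by simp
  then obtain u v where "u \<in> tree_homs k" "v \<in> tree_homs k" "u 1 = x 1" "v 1 = x 2"
    using ex_tree_hom_onto_edge[OF _ assms(2) ab] ex_tree_hom_onto_edge[OF _ assms(2) ba] by blast
  then have "(E OO E)\<^sup>*\<^sup>* (x 1) (x 2)" using invariant conn by metis
  then show ?thesis using ba vertices by (rule even_walk_edge_imp_odd_cycle)
qed

end

section \<open>The Glauber chain\<close>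

lemma rpow_nonneg: "rpow a r \<ge> 0"
  by (simp add: rpow_def)

lemma rpow_pos_iff: "rpow a r > 0 \<longleftrightarrow> r = 0 \<or> a \<noteq> 0"
  by (simp add: rpow_def)

lemma prod_prod_split_row_column:
  fixes g :: "'a \<Rightarrow> 'a \<Rightarrow> 'b :: comm_monoid_mult"
  assumes "finite K" "i \<in> K"
  shows "(\<Prod>a\<in>K. \<Prod>b\<in>K. g a b) =
    (\<Prod>a\<in>K - {i}. \<Prod>b\<in>K - {i}. g a b) * ((\<Prod>j\<in>K - {i}. g j i * g i j) * g i i)"
  using assms by (simp add: prod.remove[of K i] prod.distrib mult_ac)

locale glauber =
  fixes k n :: nat and F A :: "nat \<Rightarrow> nat \<Rightarrow> real" and \<alpha> :: "nat \<Rightarrow> real"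
  assumes motif: "motif k F" and network: "network n A \<alpha>"
    and density_pos: "hom_density k F n A \<alpha> > 0"
begin

abbreviation weight where "weight \<equiv> hom_weight k F A \<alpha>"
abbreviation site where "site \<equiv> site_weight k F A \<alpha>"
abbreviation site_sum where "site_sum x i \<equiv> (\<Sum>c\<in>{1..n}. site x i c)"
abbreviation P where "P \<equiv> glauber_kernel k F n A \<alpha>"
abbreviation \<pi> where "\<pi> \<equiv> hom_dist k F n A \<alpha>"
abbreviation S where "S \<equiv> homs k F n A \<alpha>"

definition weight_off_site :: "(nat \<Rightarrow> nat) \<Rightarrow> nat \<Rightarrow> real" where
  "weight_off_site x i = (\<Prod>a\<in>{1..k} - {i}. \<Prod>b\<in>{1..k} - {i}. rpow (A (x a) (x b)) (F a b)) *
     (\<Prod>j\<in>{1..k} - {i}. \<alpha> (x j))"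

lemma weight_eq_off_site_times_site:
  assumes "i \<in> {1..k}"
  shows "weight x = weight_off_site x i * site x i (x i)"
  unfolding hom_weight_def weight_off_site_def site_weight_def
    prod_prod_split_row_column[OF finite_atLeastAtMost assms]
    prod.remove[OF finite_atLeastAtMost assms, of "\<lambda>j. \<alpha> (x j)"]
  by (simp only: mult_ac)

lemma site_upd [simp]: "site (x(i := b)) i = site x i"
  by (rule ext) (simp add: site_weight_def cong: prod.cong_simp)

lemma weight_off_site_upd [simp]: "weight_off_site (x(i := b)) i = weight_off_site x i"
  by (simp add: weight_off_site_def cong: prod.cong_simp)

lemma weight_upd:
  assumes "i \<in> {1..k}"
  shows "weight (x(i := b)) = weight_off_site x i * site x i b"
  using weight_eq_off_site_times_site[OF assms, of "x(i := b)"] by simp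

lemma \<alpha>_pos: "a \<in> {1..n} \<Longrightarrow> \<alpha> a > 0"
  using network by (simp add: network_def)

lemma site_nonneg: "b \<in> {1..n} \<Longrightarrow> site x i b \<ge> 0"
  unfolding site_weight_def using \<alpha>_pos[of b]
  by (intro mult_nonneg_nonneg prod_nonneg) (auto simp: rpow_nonneg)

lemma mem_homs_iff: "x \<in> S \<longleftrightarrow> x \<in> {1..k} \<rightarrow>\<^sub>E {1..n} \<and> weight x > 0"
  using density_pos by (simp add: homs_def hom_dist_def zero_less_divide_iff)

lemma weight_nonneg:
  assumes "x \<in> {1..k} \<rightarrow>\<^sub>E {1..n}"
  shows "weight x \<ge> 0"
  unfolding hom_weight_def using assms \<alpha>_pos
  by (intro mult_nonneg_nonneg prod_nonneg) (auto simp: rpow_nonneg PiE_iff less_imp_le)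

lemma finite_homs: "finite S"
  by (rule finite_subset[of _ "{1..k} \<rightarrow>\<^sub>E {1..n}"]) (auto simp: homs_def intro!: finite_PiE)

lemma hom_image: "x \<in> S \<Longrightarrow> i \<in> {1..k} \<Longrightarrow> x i \<in> {1..n}"
  unfolding mem_homs_iff by (blast dest: PiE_mem)

lemma off_site_and_site_pos:
  assumes "x \<in> S" and "i \<in> {1..k}"
  shows "weight_off_site x i > 0" and "site x i (x i) > 0"
proof -
  have "weight_off_site x i * site x i (x i) > 0"
    using assms(1) weight_eq_off_site_times_site[OF assms(2), of x] by (simp add: mem_homs_iff)
  moreover have "site x i (x i) \<ge> 0"
    using site_nonneg[OF hom_image[OF assms]] .
  ultimately show "weight_off_site x i > 0" "site x i (x i) > 0"
    by (auto simp: zero_less_mult_iff)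
qed

lemma site_sum_pos:
  assumes "x \<in> S" and "i \<in> {1..k}"
  shows "site_sum x i > 0"
  using off_site_and_site_pos[OF assms] hom_image[OF assms] site_nonneg
  by (intro sum_pos2[of _ "x i"]) auto

lemma upd_mem_homs_iff:
  assumes "x \<in> S" and "i \<in> {1..k}" and "b \<in> {1..n}"
  shows "x(i := b) \<in> S \<longleftrightarrow> site x i b > 0"
proof -
  have "x(i := b) \<in> {1..k} \<rightarrow>\<^sub>E {1..n}"
    using assms by (auto simp: mem_homs_iff PiE_iff extensional_def)
  then show ?thesis
    using off_site_and_site_pos[OF assms(1,2)]
    by (simp add: mem_homs_iff weight_upd[OF assms(2)] zero_less_mult_iff)
qed

text \<open>If \<open>x = y\<close>, then every site contributes, since each may be resampled to its present value;
  otherwise at most one does.\<close>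

lemma kernel_eq:
  assumes "y \<in> S"
  shows "P x y = (\<Sum>i\<in>{1..k}.
    if y = x(i := y i) then site x i (y i) / (real k * site_sum x i) else 0)"
  unfolding glauber_kernel_def
proof (rule sum.cong[OF refl])
  fix i assume i: "i \<in> {1..k}"
  show "(\<Sum>b\<in>{1..n}. 1 / real k * (site x i b / site_sum x i) * (if y = x(i := b) then 1 else 0))
    = (if y = x(i := y i) then site x i (y i) / (real k * site_sum x i) else 0)"
  proof (cases "y = x(i := y i)")
    case True
    then have "y = x(i := b) \<longleftrightarrow> b = y i" for b by (metis fun_upd_same)
    then have "(\<Sum>b\<in>{1..n}. 1 / real k * (site x i b / site_sum x i) *
        (if y = x(i := b) then 1 else 0)) =
      (\<Sum>b\<in>{1..n}. if b = y i then site x i b / (real k * site_sum x i) else 0)"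
      by (intro sum.cong) auto
    also have "\<dots> = site x i (y i) / (real k * site_sum x i)"
      using hom_image[OF assms i] by (simp only: sum.delta finite_atLeastAtMost if_True)
    finally show ?thesis unfolding if_P[OF True] .
  next
    case False
    then have "y \<noteq> x(i := b)" for b by (metis fun_upd_same)
    with False show ?thesis by simp
  qed
qed

lemma kernel_nonneg: "x \<in> S \<Longrightarrow> y \<in> S \<Longrightarrow> P x y \<ge> 0"
  unfolding kernel_eq
  by (intro sum_nonneg) (auto intro!: divide_nonneg_nonneg mult_nonneg_nonneg sum_nonneg site_nonneg
      dest: hom_image)

lemma kernel_step_iff_single_site_move:
  "kernel_step S P x y \<longleftrightarrow> single_site_move k S x y"
proof
  assume "kernel_step S P x y"
  then have xy: "x \<in> S" "y \<in> S" and "P x y \<noteq> 0" by (auto simp: kernel_step_def)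
  have "\<exists>i\<in>{1..k}. y = x(i := y i)"
  proof (rule ccontr)
    assume "\<not> ?thesis"
    then have "P x y = 0" unfolding kernel_eq[OF xy(2)] by (intro sum.neutral) auto
    with \<open>P x y \<noteq> 0\<close> show False by simp
  qed
  with xy show "single_site_move k S x y" unfolding single_site_move_def by blast
next
  assume "single_site_move k S x y"
  then obtain i b where xy: "x \<in> S" "y \<in> S" and i: "i \<in> {1..k}" and y: "y = x(i := b)"
    by (auto simp: single_site_move_def)
  have b: "b \<in> {1..n}" using hom_image[OF xy(2) i] y by simp
  have "P x y > 0"
    unfolding kernel_eq[OF xy(2)]
  proof (rule sum_pos2[OF _ i])
    have "site x i b > 0" "site_sum x i > 0"
      using upd_mem_homs_iff[OF xy(1) i b] site_sum_pos[OF xy(1) i] xy(2) y by simp_all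
    then show "0 < (if y = x(i := y i) then site x i (y i) / (real k * site_sum x i) else 0)"
      using i by (simp add: y)
  qed (use xy in \<open>auto intro!: divide_nonneg_nonneg mult_nonneg_nonneg sum_nonneg site_nonneg
      dest: hom_image\<close>)
  with xy show "kernel_step S P x y" by (simp add: kernel_step_def)
qed

lemma stochastic_glauber: "stochastic S P"
proof -
  have "(\<Sum>y\<in>S. P x y) = 1" if x: "x \<in> S" for x
  proof -
    have mass: "(\<Sum>y\<in>S. 1 / real k * (site x i b / site_sum x i) * (if y = x(i := b) then 1 else 0))
        = 1 / real k * (site x i b / site_sum x i)"
      if "i \<in> {1..k}" "b \<in> {1..n}" for i b
    proof (cases "x(i := b) \<in> S")
      case True
      then show ?thesis unfolding sum_distrib_left[symmetric] using finite_homs by simp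
    next
      case False
      \<comment> \<open>an update that would leave the homomorphisms is never proposed\<close>
      then have "site x i b = 0"
        using upd_mem_homs_iff[OF x that] site_nonneg[OF that(2), of x i] by linarith
      then show ?thesis by simp
    qed
    have "(\<Sum>y\<in>S. P x y) = (\<Sum>i\<in>{1..k}. \<Sum>b\<in>{1..n}. \<Sum>y\<in>S.
        1 / real k * (site x i b / site_sum x i) * (if y = x(i := b) then 1 else 0))"
      unfolding glauber_kernel_def
      by (subst sum.swap, rule sum.cong[OF refl], rule sum.swap)
    also have "\<dots> = (\<Sum>i\<in>{1..k}. \<Sum>b\<in>{1..n}. 1 / real k * (site x i b / site_sum x i))"
      by (intro sum.cong refl mass)
    also have "\<dots> = (\<Sum>i\<in>{1..k}. 1 / real k)"
    proof (rule sum.cong[OF refl])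
      fix i assume i: "i \<in> {1..k}"
      have "site_sum x i > 0" using site_sum_pos[OF x i] .
      then show "(\<Sum>b\<in>{1..n}. 1 / real k * (site x i b / site_sum x i)) = 1 / real k"
        unfolding sum_distrib_left[symmetric] sum_divide_distrib[symmetric] by simp
    qed
    also have "\<dots> = 1" using motif by (simp add: motif_def)
    finally show ?thesis .
  qed
  with kernel_nonneg show ?thesis by (simp add: stochastic_def)
qed

text \<open>Detailed balance holds for each site separately: if \<open>x\<close> and \<open>y\<close> differ at most at \<open>i\<close>, then
  both weights have the same factor from outside \<open>i\<close> and both updates are normalised by the same
  sum, so both sides contain the product of the site weights of \<open>x i\<close> and \<open>y i\<close>.\<close>

lemma reversible_glauber: "reversible S P \<pi>"
  unfolding reversible_def
proof (intro ballI)
  fix x y assume x: "x \<in> S" and y: "y \<in> S"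
  have "weight x * P x y = weight y * P y x"
    unfolding kernel_eq[OF x] kernel_eq[OF y]
      sum_distrib_left[where r = "weight x"] sum_distrib_left[where r = "weight y"]
  proof (rule sum.cong[OF refl])
    fix i assume i: "i \<in> {1..k}"
    show "weight x * (if y = x(i := y i) then site x i (y i) / (real k * site_sum x i) else 0) =
      weight y * (if x = y(i := x i) then site y i (x i) / (real k * site_sum y i) else 0)"
    proof (cases "y = x(i := y i)")
      case True
      have "site y i = site x i" "weight_off_site y i = weight_off_site x i"
        by (subst True, rule site_upd) (subst True, rule weight_off_site_upd)
      moreover have x_eq: "x = y(i := x i)" using True by (metis fun_upd_triv fun_upd_upd)
      ultimately show ?thesis
        unfolding if_P[OF True] if_P[OF x_eq] weight_eq_off_site_times_site[OF i] by simp
    next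
      case False
      then have "x \<noteq> y(i := x i)" by (metis fun_upd_triv fun_upd_upd)
      with False show ?thesis by simp
    qed
  qed
  then show "\<pi> x * P x y = \<pi> y * P y x" by (simp add: hom_dist_def)
qed

lemma hom_dist_sum: "(\<Sum>x\<in>S. \<pi> x) = 1"
proof -
  have "(\<Sum>x\<in>S. weight x) = hom_density k F n A \<alpha>"
    unfolding hom_density_def
  proof (rule sum.mono_neutral_left)
    show "S \<subseteq> {1..k} \<rightarrow>\<^sub>E {1..n}" by (auto simp: homs_def)
    show "\<forall>x\<in>({1..k} \<rightarrow>\<^sub>E {1..n}) - S. weight x = 0"
      using weight_nonneg by (force simp: mem_homs_iff)
  qed (auto intro!: finite_PiE)
  then show ?thesis
    using density_pos by (simp add: hom_dist_def flip: sum_divide_distrib)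
qed

lemma hom_dist_stationary: "stationary_distribution S P \<pi>"
  by (rule reversible_imp_stationary[OF stochastic_glauber reversible_glauber _ hom_dist_sum])
    (auto simp: homs_def)

lemma hom_dist_unique_stationary:
  assumes "irreducible_kernel S P" and "stationary_distribution S P \<mu>" and "x \<in> S"
  shows "\<mu> x = \<pi> x"
  by (rule reversible_stationary_unique[OF finite_homs stochastic_glauber reversible_glauber
        assms(1) _ hom_dist_sum assms(2,3)]) (simp add: homs_def)

lemma irreducible_glauber_iff:
  "irreducible_kernel S P \<longleftrightarrow> (\<forall>x\<in>S. \<forall>y\<in>S. (single_site_move k S)\<^sup>*\<^sup>* x y)"
proof -
  have "kernel_step S P = single_site_move k S"
    by (intro ext) (rule kernel_step_iff_single_site_move)
  then show ?thesis
    by (simp add: irreducible_kernel_iff_reachable[OF finite_homs] kernel_nonneg)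
qed

lemma weight_pos_iff:
  assumes "x \<in> {1..k} \<rightarrow>\<^sub>E {1..n}"
  shows "weight x > 0 \<longleftrightarrow> (\<forall>i\<in>{1..k}. \<forall>j\<in>{1..k}. F i j \<noteq> 0 \<longrightarrow> A (x i) (x j) \<noteq> 0)"
proof -
  have "\<alpha> (x i) \<noteq> 0" if "i \<in> {1..k}" for i
    using \<alpha>_pos[OF PiE_mem[OF assms that]] by simp
  moreover have "rpow a r = 0 \<longleftrightarrow> r \<noteq> 0 \<and> a = 0" for a r
    using rpow_pos_iff[of a r] rpow_nonneg[of a r] by auto
  ultimately have "weight x \<noteq> 0 \<longleftrightarrow> (\<forall>i\<in>{1..k}. \<forall>j\<in>{1..k}. F i j \<noteq> 0 \<longrightarrow> A (x i) (x j) \<noteq> 0)"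
    by (auto simp: hom_weight_def)
  with weight_nonneg[OF assms] show ?thesis by linarith
qed

end

section \<open>Tree motifs in bidirectional networks\<close>

text \<open>The skeleton, cut down to the nodes of the network: the values of \<open>A\<close> elsewhere are
  arbitrary and could link two nodes by a path through numbers outside \<open>{1..n}\<close>.\<close>

definition link :: "nat \<Rightarrow> (nat \<Rightarrow> nat \<Rightarrow> real) \<Rightarrow> nat \<Rightarrow> nat \<Rightarrow> bool" where
  "link n A a b \<longleftrightarrow> a \<in> {1..n} \<and> b \<in> {1..n} \<and> skeleton A a b"

lemma symp_link: "symp (link n A)"
  by (auto simp: symp_def link_def skeleton_def)

lemma bipartite_iff_no_odd_link_cycle: "bipartite n A \<longleftrightarrow> (\<nexists>c. odd_cycle n (link n A) c)"
proof -
  have "odd_cycle n (skeleton A) c \<longleftrightarrow> odd_cycle n (link n A) c" for c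
  proof -
    have "c ! (i mod length c) \<in> set c" if "c \<noteq> []" for i
      using that by (intro nth_mem) simp
    then have "c ! i \<in> {1..n} \<and> c ! (Suc i mod length c) \<in> {1..n}"
      if "i < length c" "set c \<subseteq> {1..n}" for i
      using that by (metis length_0_conv not_less_zero nth_mem subsetD)
    then show ?thesis
      unfolding odd_cycle_def link_def by blast
  qed
  then show ?thesis by (simp add: bipartite_def)
qed

lemma bidirectional_link_iff:
  assumes "network n A \<alpha>" and "bidirectional n A" and "a \<in> {1..n}" and "b \<in> {1..n}"
  shows "link n A a b \<longleftrightarrow> A a b \<noteq> 0"
proof -
  have "A a b \<ge> 0" using assms by (simp add: network_def)
  then have "A a b \<noteq> 0 \<longleftrightarrow> A a b > 0" by auto
  moreover have "A a b > 0 \<longleftrightarrow> A b a > 0" using assms by (simp add: bidirectional_def)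
  ultimately show ?thesis using assms(3,4) by (auto simp: link_def skeleton_def)
qed

lemma irreducible_network_link_connected:
  assumes net: "network n A \<alpha>" and bi: "bidirectional n A" and irr: "irreducible_network n A \<alpha>"
  shows "\<forall>a\<in>{1..n}. \<forall>b\<in>{1..n}. (link n A)\<^sup>*\<^sup>* a b"
proof -
  let ?W = "walk_kernel n A \<alpha>"
  have term_nonneg: "\<alpha> a * max (A a b) (A b a) * \<alpha> b \<ge> 0" if "a \<in> {1..n}" "b \<in> {1..n}" for a b
    using net that by (intro mult_nonneg_nonneg) (auto simp: network_def less_imp_le le_max_iff_disj)
  then have nonneg: "\<forall>a\<in>{1..n}. \<forall>b\<in>{1..n}. ?W a b \<ge> 0"
    unfolding walk_kernel_def by (intro ballI divide_nonneg_nonneg sum_nonneg) auto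
  have "link n A a b" if "kernel_step {1..n} ?W a b" for a b
  proof -
    have ab: "a \<in> {1..n}" "b \<in> {1..n}" and "?W a b \<noteq> 0" using that by (auto simp: kernel_step_def)
    then have "max (A a b) (A b a) \<noteq> 0" by (auto simp: walk_kernel_def)
    then have "A a b \<noteq> 0 \<or> A b a \<noteq> 0" by (auto simp: max_def split: if_splits)
    then have "link n A a b \<or> link n A b a"
      using bidirectional_link_iff[OF net bi] ab by blast
    then show ?thesis using sympD[OF symp_link] by blast
  qed
  then have "(kernel_step {1..n} ?W)\<^sup>*\<^sup>* a b \<Longrightarrow> (link n A)\<^sup>*\<^sup>* a b" for a b
    by (rule mono_rtranclp[rule_format])
  with irr show ?thesis
    unfolding irreducible_network_def irreducible_kernel_iff_reachable[OF finite_atLeastAtMost nonneg]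
    by blast
qed

text \<open>The only nonzero exponents of a tree motif are those on the edges from a parent to its child, so
  a weight is positive as soon as no such edge is sent to a pair with \<open>A = 0\<close>. Bidirectionality
  makes the direction of the edges irrelevant.\<close>

lemma (in glauber) tree_motif_homs:
  assumes tree: "rooted_tree_motif k F" and bi: "bidirectional n A"
  obtains p where "tree_to_graph.parents_below p k"
    and "S = tree_to_graph.tree_homs p (link n A) n k"
proof -
  have "\<forall>i\<in>{2..k}. \<exists>j. j \<in> {1..k} \<and> F j i > 0"
    using tree unfolding rooted_tree_motif_def by blast
  then obtain p where p: "\<forall>i\<in>{2..k}. p i \<in> {1..k} \<and> F (p i) i > 0"
    by metis
  have p_less: "p i < i" if "i \<in> {2..k}" for i
    using tree p that unfolding rooted_tree_motif_def by blast
  have only: "i \<in> {2..k} \<and> j = p i" if "F j i \<noteq> 0" "i \<in> {1..k}" "j \<in> {1..k}" for i j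
  proof -
    have "i \<noteq> 1" "j \<noteq> i" using tree that unfolding rooted_tree_motif_def by metis+
    moreover have "F j i > 0" using motif that by (auto simp: motif_def less_le)
    moreover have i: "i \<in> {2..k}" using that \<open>i \<noteq> 1\<close> by auto
    ultimately have "j = p i"
      using tree p p_less[OF i] that unfolding rooted_tree_motif_def by (metis less_irrefl)
    with i show ?thesis by simp
  qed
  interpret tree_to_graph p "link n A" n
    by unfold_locales (rule symp_link, simp add: link_def)
  have "parents_below k" using p p_less by (simp add: parents_below_def)
  moreover have "S = tree_homs k"
  proof (rule set_eqI)
    fix x
    have "weight x > 0 \<longleftrightarrow> (\<forall>i\<in>{2..k}. link n A (x (p i)) (x i))" if x: "x \<in> {1..k} \<rightarrow>\<^sub>E {1..n}"
    proof -
      have V: "x i \<in> {1..n}" if "i \<in> {1..k}" for i using x that by (rule PiE_mem)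
      have "weight x > 0 \<longleftrightarrow> (\<forall>i\<in>{2..k}. A (x (p i)) (x i) \<noteq> 0)"
      proof
        assume "weight x > 0"
        then show "\<forall>i\<in>{2..k}. A (x (p i)) (x i) \<noteq> 0"
          using p unfolding weight_pos_iff[OF x] by force
      next
        assume "\<forall>i\<in>{2..k}. A (x (p i)) (x i) \<noteq> 0"
        then show "weight x > 0"
          unfolding weight_pos_iff[OF x] using only by metis
      qed
      moreover have "link n A (x (p i)) (x i) \<longleftrightarrow> A (x (p i)) (x i) \<noteq> 0" if "i \<in> {2..k}" for i
        using bidirectional_link_iff[OF network bi] V[of i] V[of "p i"] p that by auto
      ultimately show ?thesis by blast
    qed
    then show "x \<in> S \<longleftrightarrow> x \<in> tree_homs k" by (auto simp: mem_homs_iff tree_homs_def)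
  qed
  ultimately show ?thesis by (rule that)
qed

theorem theorem2p1:
  fixes k n :: nat
    and F A :: "nat \<Rightarrow> nat \<Rightarrow> real"
    and \<alpha> :: "nat \<Rightarrow> real"
  assumes "motif k F"
    and "network n A \<alpha>"
    and "irreducible_network n A \<alpha>"
    and "hom_density k F n A \<alpha> > 0"
  shows
    "stationary_distribution (homs k F n A \<alpha>) (glauber_kernel k F n A \<alpha>) (hom_dist k F n A \<alpha>)
     \<and> (rooted_tree_motif k F \<and> bidirectional n A \<longrightarrow>
         (\<not> bipartite n A \<longrightarrow> irreducible_kernel (homs k F n A \<alpha>) (glauber_kernel k F n A \<alpha>))
       \<and> (k \<ge> 2 \<longrightarrow>
            irreducible_kernel (homs k F n A \<alpha>) (glauber_kernel k F n A \<alpha>) \<longrightarrow> \<not> bipartite n A)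
       \<and> (\<not> bipartite n A \<longrightarrow>
            stationary_distribution (homs k F n A \<alpha>) (glauber_kernel k F n A \<alpha>) (hom_dist k F n A \<alpha>)
          \<and> (\<forall>\<mu>. stationary_distribution (homs k F n A \<alpha>) (glauber_kernel k F n A \<alpha>) \<mu> \<longrightarrow>
                (\<forall>x\<in>homs k F n A \<alpha>. \<mu> x = hom_dist k F n A \<alpha> x))))"
proof -
  interpret glauber k n F A \<alpha>
    by unfold_locales (use assms in auto)
  have "(\<not> bipartite n A \<longrightarrow> irreducible_kernel S P) \<and>
      (k \<ge> 2 \<longrightarrow> irreducible_kernel S P \<longrightarrow> \<not> bipartite n A)"
    if tree: "rooted_tree_motif k F" and bi: "bidirectional n A"
  proof -
    obtain p where par: "tree_to_graph.parents_below p k"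
      and homs: "S = tree_to_graph.tree_homs p (link n A) n k"
      by (rule tree_motif_homs[OF tree bi])
    note irr_iff = irreducible_glauber_iff[unfolded homs]
    interpret tree_to_graph p "link n A" n
      by unfold_locales (rule symp_link, simp add: link_def)
    have k: "k \<ge> 1" using assms(1) by (simp add: motif_def)
    have "irreducible_kernel S P" if "\<not> bipartite n A"
    proof -
      obtain c where c: "odd_cycle n (link n A) c"
        using \<open>\<not> bipartite n A\<close> by (auto simp: bipartite_iff_no_odd_link_cycle)
      have "(link n A OO link n A)\<^sup>*\<^sup>* a b" if "a \<in> {1..n}" "b \<in> {1..n}" for a b
        by (rule odd_cycle_imp_even_walks[OF symp_link
              irreducible_network_link_connected[OF assms(2) bi assms(3)] c that])
      then show ?thesis
        using tree_homs_connected[OF k par] unfolding homs irr_iff by blast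
    qed
    moreover have "\<not> bipartite n A" if "k \<ge> 2" and irr: "irreducible_kernel S P"
    proof -
      have "S \<noteq> {}" using hom_dist_sum by auto
      then obtain x where "x \<in> tree_homs k" unfolding homs by blast
      with connected_imp_odd_cycle[OF that(1) par _ this] irr show ?thesis
        unfolding homs irr_iff bipartite_iff_no_odd_link_cycle by blast
    qed
    ultimately show ?thesis by blast
  qed
  with hom_dist_stationary hom_dist_unique_stationary show ?thesis by blast
qed

end
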